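(* Let $S$ be a discrete abelian cancellative semigroup with unit $e$. Then the strong boundary $\Gamma$ of the uniform algebra $A(\widehat S)$ is a union of maximal subgroups of the semigroup $\widehat S$, i.e. $$\Gamma=\coprod_{\rho\in F}\rho X$$ (disjoint union), where $F$ is contained in $E(\widehat S)$. If $S$ is countable, then $1\in F$ and $E_0(\widehat S)\cap F=\emptyset$.
   Context: $S$ is a discrete abelian cancellative semigroup with unit $e$, written multiplicatively. A semicharacter of $S$ is a homomorphism $\psi$ from $S$ to the multiplicative semigroup $\overline{\mathbb D}=\{z\in\mathbb C:|z|\le 1\}$ that is not identically zero. $\widehat S$ is the set of all semicharacters with pointwise multiplication and the topology of pointwise convergence on $S$; it is a compact topological semigroup with unit $1$ (the constant function). $\widehat S_+\subseteq\widehat S$ is the set of nonnegative semicharacters, $E(\widehat S)$ the set of idempotents of $\widehat S$ (semicharacters taking only the values $0$ and $1$), and $X\subseteq\widehat S$ the compact group of characters (semicharacters of modulus $1$ everywhere). For $\rho\in\widehat S_+$ put $S(\rho)=\{s\in S:\rho(s)>0\}$; for $\mathrm{Re}\,z>0$, $\rho^z(s)=\rho(s)^z$ (with $0^z=0$), and $\rho^0$ is the indicator function of $S(\rho)$. A maximal subgroup of $\widehat S$ is the largest subgroup $H(\rho)$ of $\widehat S$ containing a given idempotent $\rho\in E(\widehat S)$. A function $f:\widehat S\setminus X\to\mathbb C$ is generalized analytic if for all $\rho,\psi\in\widehat S\setminus X$ with $\rho\ge 0$ the map $z\mapsto f(\rho^z\psi)$ is analytic in the open right half-plane $\{\mathrm{Re}\,z>0\}$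 and continuous at $+0$. $A(\widehat S)$ is the uniform algebra (sup norm) of all functions continuous on $\widehat S$ and generalized analytic on $\widehat S\setminus X$. The strong boundary of a uniform algebra $A$ on a compact space $Y$ is the set of all its $p$-points, i.e. of the points $y\in Y$ such that $\{y\}$ is an intersection of peak sets of $A$. $E_0(\widehat S)$ is the set of those $\rho_0\in E(\widehat S)$ for each of which there is $\rho_1\in\widehat S_+$ such that $\rho_1(s)=1$ for $s\in S(\rho_0)$ and $0<\rho_1(s)<1$ for $s\notin S(\rho_0)$.
   Formalization: In the definition of E_0 the case ρ_0 = 1 (i.e. S(ρ_0) = S) is excluded; read literally, ρ_1 = 1 would put 1 in E_0 for every S, contradicting "1 ∈ F and E_0 ∩ F = ∅". *)

theory Defs
  imports "HOL-Analysis.Analysis" "HOL-Algebra.Group" "HOL-Library.Function_Algebras"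
    "HOL-Library.Complex_Order"
begin

text \<open>
  Semicharacters are elements of the function type \<^typ>\<open>'a \<Rightarrow> complex\<close>, whose product and unit \<open>1\<close>
  are the pointwise ones and whose topology is that of pointwise convergence. The order on
  \<^typ>\<open>complex\<close> is the one where \<open>0 \<le> z\<close> means that \<open>z\<close> is real and nonnegative.
\<close>

definition semicharacters :: "('a::comm_monoid_mult \<Rightarrow> complex) set" where
  "semicharacters =
     {\<psi>. (\<forall>s t. \<psi> (s * t) = \<psi> s * \<psi> t) \<and> (\<forall>s. cmod (\<psi> s) \<le> 1) \<and> (\<exists>s. \<psi> s \<noteq> 0)}"

definition nonneg_semicharacters :: "('a::comm_monoid_mult \<Rightarrow> complex) set" where
  "nonneg_semicharacters = {\<rho> \<in> semicharacters. \<forall>s. 0 \<le> \<rho> s}"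

definition idempotent_semicharacters :: "('a::comm_monoid_mult \<Rightarrow> complex) set" where
  "idempotent_semicharacters = {\<rho> \<in> semicharacters. \<rho> * \<rho> = \<rho>}"

definition characters :: "('a::comm_monoid_mult \<Rightarrow> complex) set" where
  "characters = {\<psi> \<in> semicharacters. \<forall>s. cmod (\<psi> s) = 1}"

definition pos_set :: "('a \<Rightarrow> complex) \<Rightarrow> 'a set" where
  "pos_set \<rho> = {s. 0 < \<rho> s}"

text \<open>
  Since \<open>0 powr z = 0\<close> for every \<open>z\<close> and \<open>x powr 0 = 1\<close> for \<open>x \<noteq> 0\<close>, the function \<open>cpower \<rho> 0\<close> is
  the indicator function of \<open>pos_set \<rho>\<close> for nonnegative \<open>\<rho>\<close>.
\<close>

definition cpower :: "('a \<Rightarrow> complex) \<Rightarrow> complex \<Rightarrow> 'a \<Rightarrow> complex" where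
  "cpower \<rho> z = (\<lambda>s. \<rho> s powr z)"

text \<open>
  A subgroup of the semigroup of semicharacters may have any idempotent as its unit, not only \<open>1\<close>.
\<close>

definition is_subgroup :: "('a::comm_monoid_mult \<Rightarrow> complex) set \<Rightarrow> bool" where
  "is_subgroup G \<longleftrightarrow> G \<subseteq> semicharacters \<and> (\<exists>u. group \<lparr>carrier = G, monoid.mult = (*), one = u\<rparr>)"

definition is_maximal_subgroup ::
    "('a::comm_monoid_mult \<Rightarrow> complex) \<Rightarrow> ('a \<Rightarrow> complex) set \<Rightarrow> bool" where
  "is_maximal_subgroup \<rho> H \<longleftrightarrow>
     is_subgroup H \<and> \<rho> \<in> H \<and> (\<forall>G. is_subgroup G \<and> \<rho> \<in> G \<longrightarrow> G \<subseteq> H)"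

definition generalized_analytic :: "(('a::comm_monoid_mult \<Rightarrow> complex) \<Rightarrow> complex) \<Rightarrow> bool" where
  "generalized_analytic f \<longleftrightarrow>
     (\<forall>\<rho> \<in> semicharacters - characters. \<forall>\<psi> \<in> semicharacters - characters. (\<forall>s. 0 \<le> \<rho> s) \<longrightarrow>
        (\<lambda>z. f (cpower \<rho> z * \<psi>)) analytic_on {z. 0 < Re z} \<and>
        ((\<lambda>t::real. f (cpower \<rho> (of_real t) * \<psi>)) \<longlongrightarrow> f (cpower \<rho> 0 * \<psi>)) (at_right 0))"

text \<open>
  The members of the algebra are total functions on \<^typ>\<open>'a \<Rightarrow> complex\<close>; only their restrictions to
  \<open>semicharacters\<close> matter.
\<close>

definition gen_analytic_algebra :: "(('a::comm_monoid_mult \<Rightarrow> complex) \<Rightarrow> complex) set" where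
  "gen_analytic_algebra = {f. continuous_on semicharacters f \<and> generalized_analytic f}"

definition peak_set :: "'b set \<Rightarrow> ('b \<Rightarrow> complex) set \<Rightarrow> 'b set \<Rightarrow> bool" where
  "peak_set Y A P \<longleftrightarrow>
     P \<subseteq> Y \<and> (\<exists>f\<in>A. (\<forall>y\<in>P. f y = 1) \<and> (\<forall>y\<in>Y - P. cmod (f y) < 1))"

definition p_point :: "'b set \<Rightarrow> ('b \<Rightarrow> complex) set \<Rightarrow> 'b \<Rightarrow> bool" where
  "p_point Y A y \<longleftrightarrow> y \<in> Y \<and> (\<exists>\<P>. \<P> \<noteq> {} \<and> (\<forall>P\<in>\<P>. peak_set Y A P) \<and> \<Inter>\<P> = {y})"

definition strong_boundary :: "'b set \<Rightarrow> ('b \<Rightarrow> complex) set \<Rightarrow> 'b set" where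
  "strong_boundary Y A = {y. p_point Y A y}"

text \<open>
  The condition on \<open>\<rho>\<^sub>1\<close> outside \<open>pos_set \<rho>\<^sub>0\<close> is meant for a nonempty complement: if
  \<open>pos_set \<rho>\<^sub>0 = UNIV\<close> were admitted, then \<open>\<rho>\<^sub>1 = 1\<close> would always witness that \<open>\<rho>\<^sub>0 = 1\<close> belongs to
  this set.
\<close>

definition E0_semicharacters :: "('a::comm_monoid_mult \<Rightarrow> complex) set" where
  "E0_semicharacters =
     {\<rho>\<^sub>0 \<in> idempotent_semicharacters. pos_set \<rho>\<^sub>0 \<noteq> UNIV \<and>
        (\<exists>\<rho>\<^sub>1 \<in> nonneg_semicharacters.
           (\<forall>s \<in> pos_set \<rho>\<^sub>0. \<rho>\<^sub>1 s = 1) \<and> (\<forall>s. s \<notin> pos_set \<rho>\<^sub>0 \<longrightarrow> 0 < \<rho>\<^sub>1 s \<and> \<rho>\<^sub>1 s < 1))}"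

end

theory Submission
  imports Defs "HOL-Complex_Analysis.Conformal_Mappings" "HOL-Real_Asymp.Real_Asymp"
begin

text \<open>
  By cancellation, the phase of a semicharacter extends from its support to a character of the whole
  semigroup (the circle group is divisible), so every semicharacter \<open>\<psi>\<close> is \<open>\<bar>\<psi>\<bar> \<theta>\<close> with a character
  \<open>\<theta>\<close>. The algebra is invariant under translation by characters, hence so is its strong boundary, and it
  remains to see that a \<open>p\<close>-point has idempotent modulus: otherwise \<open>\<bar>\<psi>\<bar>\<^sup>z \<theta>\<close> would be an analytic disc
  through \<open>\<psi>\<close>, on which every function that peaks at \<open>\<psi>\<close> is constant. The point \<open>1\<close> is the
  intersection of the peak sets of the functions \<open>\<psi> \<mapsto> (1 + \<psi> s) / 2\<close>.
\<close>

section \<open>Extension of unimodular characters\<close>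

text \<open>A graph instead of a function, so that extension is plain inclusion and the union of a
  chain is again a candidate for Zorn's lemma.\<close>

definition partial_character :: "('a::comm_monoid_mult \<times> complex) set \<Rightarrow> bool" where
  "partial_character G \<longleftrightarrow> (1, 1) \<in> G \<and>
     (\<forall>s a t b. (s, a) \<in> G \<longrightarrow> (t, b) \<in> G \<longrightarrow> (s * t, a * b) \<in> G) \<and>
     (\<forall>s a. (s, a) \<in> G \<longrightarrow> cmod a = 1) \<and>
     (\<forall>s a b. (s, a) \<in> G \<longrightarrow> (s, b) \<in> G \<longrightarrow> a = b)"

lemma partial_characterD:
  assumes "partial_character G"
  shows "(1, 1) \<in> G"
    and "(s, a) \<in> G \<Longrightarrow> (t, b) \<in> G \<Longrightarrow> (s * t, a * b) \<in> G"
    and "(s, a) \<in> G \<Longrightarrow> cmod a = 1"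
    and "(s, a) \<in> G \<Longrightarrow> (s, b) \<in> G \<Longrightarrow> a = b"
  using assms unfolding partial_character_def by blast+

text \<open>A value \<open>w\<close> for \<open>s\<close> has to respect every relation
  \<open>t * s ^ k = t'\<close> between elements of the domain. If there is one with
  \<open>k > 0\<close>, \<open>w\<close> is a root fitted to a relation of least exponent
  \<open>d\<close>; the others reduce to it by lowering the exponent by \<open>d\<close>, as in
  Euclid's algorithm.\<close>

lemma partial_character_new_value:
  fixes s :: "'a::comm_monoid_mult"
  assumes G: "partial_character G"
  obtains w where "cmod w = 1"
    and "\<And>k t a t' b. (t, a) \<in> G \<Longrightarrow> (t', b) \<in> G \<Longrightarrow> t * s ^ k = t' \<Longrightarrow> a * w ^ k = b"
proof -
  define K where "K k \<longleftrightarrow> 0 < k \<and> (\<exists>t a t' b. (t, a) \<in> G \<and> (t', b) \<in> G \<and> t * s ^ k = t')" for k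
  show thesis
  proof (cases "\<exists>k. K k")
    case False
    have "a * 1 ^ k = b" if "(t, a) \<in> G" "(t', b) \<in> G" "t * s ^ k = t'" for k t a t' b
    proof -
      have "\<not> K k" using False by blast
      then have "k = 0" using that unfolding K_def by auto
      then show ?thesis using that partial_characterD(4)[OF G] by simp
    qed
    then show thesis by (intro that[of 1]) auto
  next
    case True
    define d where "d = (LEAST k. K k)"
    have "K d" unfolding d_def using True by (rule LeastI_ex)
    then obtain t0 a0 t0' b0 where d: "0 < d" and 0: "(t0, a0) \<in> G" "(t0', b0) \<in> G" "t0 * s ^ d = t0'"
      unfolding K_def by blast
    have n0: "cmod a0 = 1" "cmod b0 = 1" using 0 partial_characterD(3)[OF G] by blast+
    then have a0: "a0 \<noteq> 0" by auto
    obtain w where w: "b0 / a0 = w ^ d" using exists_complex_root[of d "b0 / a0"] d by auto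
    have "cmod w ^ d = 1" using w n0 by (metis norm_divide norm_power div_by_1)
    then have nw: "cmod w = 1" using d by (metis norm_ge_zero power_eq_imp_eq_base power_one zero_le_one)
    have "a * w ^ k = b" if "(t, a) \<in> G" "(t', b) \<in> G" "t * s ^ k = t'" for k t a t' b
      using that
    proof (induction k arbitrary: t a t' b rule: less_induct)
      case (less k)
      show ?case
      proof (cases "k = 0")
        case True
        then show ?thesis using less.prems partial_characterD(4)[OF G] by simp
      next
        case False
        then have "K k" using less.prems unfolding K_def by auto
        then have dk: "d \<le> k" unfolding d_def by (rule Least_le)
        then have sk: "s ^ k = s ^ d * s ^ (k - d)" "w ^ k = w ^ d * w ^ (k - d)"
          by (simp_all flip: power_add)
        \<comment> \<open>Multiplying the given relation by \<open>t0\<close> and using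
          \<open>t0 * s ^ d = t0'\<close> leaves a relation of exponent
          \<open>k - d\<close>.\<close>
        have "t * t0' * s ^ (k - d) = t' * t0"
          using less.prems(3) 0(3) sk(1) by (metis mult.assoc mult.commute)
        then have "a * b0 * w ^ (k - d) = b * a0"
          using less.IH[of "k - d" "t * t0'" "a * b0" "t' * t0" "b * a0"] d dk
            partial_characterD(2)[OF G] less.prems 0 by simp
        moreover have "b0 = a0 * w ^ d" using w a0 by (simp add: field_simps)
        ultimately have "a0 * (a * w ^ k) = a0 * b" by (simp add: sk(2) mult_ac)
        then show ?thesis using a0 by simp
      qed
    qed
    then show thesis using that nw by blast
  qed
qed

text \<open>The extension lives on the products \<open>t * s ^ n\<close>. Two representations of one
  element are compared by cancelling the smaller power of \<open>s\<close>, which leaves a relation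
  that \<open>w\<close> respects.\<close>

lemma partial_character_extend:
  fixes s :: "'a::comm_monoid_mult"
  assumes cancel: "\<forall>a b c :: 'a. a * b = a * c \<longrightarrow> b = c"
    and G: "partial_character G"
  obtains G' w where "partial_character G'" "G \<subseteq> G'" "(s, w) \<in> G'"
proof -
  obtain w where w: "cmod w = 1"
    and ww: "\<And>k t a t' b. (t, a) \<in> G \<Longrightarrow> (t', b) \<in> G \<Longrightarrow> t * s ^ k = t' \<Longrightarrow> a * w ^ k = b"
    using partial_character_new_value[OF G] by blast
  define G' where "G' = {(t * s ^ n, a * w ^ n) | t a n. (t, a) \<in> G}"
  have le: "a * w ^ n = b * w ^ m"
    if "(t, a) \<in> G" "(t', b) \<in> G" "t * s ^ n = t' * s ^ m" "m \<le> n" for t a n t' b m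
  proof -
    have sn: "s ^ n = s ^ m * s ^ (n - m)" "w ^ n = w ^ m * w ^ (n - m)"
      using that(4) by (simp_all flip: power_add)
    then have "s ^ m * (t * s ^ (n - m)) = s ^ m * t'"
      using that(3) by (simp add: mult_ac)
    then have "t * s ^ (n - m) = t'" using cancel by blast
    then have "a * w ^ (n - m) = b" using ww that by blast
    then show ?thesis by (simp add: sn(2) mult_ac)
  qed
  have sub: "G \<subseteq> G'"
  proof
    fix p assume "p \<in> G"
    then show "p \<in> G'" unfolding G'_def
      by (cases p) (force intro: exI[of _ "0::nat"])
  qed
  have "partial_character G'"
    unfolding partial_character_def
  proof (intro conjI allI impI)
    show "(1, 1) \<in> G'" using sub partial_characterD(1)[OF G] by blast
  next
    fix x a y b assume "(x, a) \<in> G'" "(y, b) \<in> G'"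
    then obtain t a' n t' b' m where
      "(t, a') \<in> G" "x = t * s ^ n" "a = a' * w ^ n" "(t', b') \<in> G" "y = t' * s ^ m" "b = b' * w ^ m"
      unfolding G'_def by blast
    moreover from this have "x * y = (t * t') * s ^ (n + m)" "a * b = (a' * b') * w ^ (n + m)"
      by (simp_all add: power_add mult_ac)
    ultimately show "(x * y, a * b) \<in> G'"
      using partial_characterD(2)[OF G] unfolding G'_def by blast
  next
    fix x a assume "(x, a) \<in> G'"
    then show "cmod a = 1"
      using partial_characterD(3)[OF G] w unfolding G'_def by (auto simp: norm_mult norm_power)
  next
    fix x a b assume "(x, a) \<in> G'" "(x, b) \<in> G'"
    then obtain t a' n t' b' m where "(t, a') \<in> G" "x = t * s ^ n" "a = a' * w ^ n"
      "(t', b') \<in> G" "x = t' * s ^ m" "b = b' * w ^ m"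
      unfolding G'_def by blast
    then show "a = b" using le[of t a' t' b' n m] le[of t' b' t a' m n] by (cases "m \<le> n") auto
  qed
  moreover have "(s, w) \<in> G'"
  proof -
    have "(1 * s ^ 1, 1 * w ^ 1) \<in> G'" unfolding G'_def using partial_characterD(1)[OF G] by blast
    then show ?thesis by simp
  qed
  ultimately show thesis using sub that by blast
qed

text \<open>Zorn's lemma: a maximal extension is defined everywhere, since any \<open>s\<close>
  outside its domain could be adjoined.\<close>

lemma partial_character_extends_to_character:
  fixes G :: "('a::comm_monoid_mult \<times> complex) set"
  assumes cancel: "\<forall>a b c :: 'a. a * b = a * c \<longrightarrow> b = c"
    and G: "partial_character G"
  obtains \<theta> where "\<theta> \<in> characters" "\<And>s a. (s, a) \<in> G \<Longrightarrow> \<theta> s = a"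
proof -
  define \<A> where "\<A> = {H. partial_character H \<and> G \<subseteq> H}"
  have "\<exists>M\<in>\<A>. \<forall>H\<in>\<A>. M \<subseteq> H \<longrightarrow> H = M"
  proof (rule subset_Zorn_nonempty)
    show "\<A> \<noteq> {}" using G unfolding \<A>_def by blast
  next
    fix \<C> assume ne: "\<C> \<noteq> {}" and "subset.chain \<A> \<C>"
    then have sub: "\<And>H. H \<in> \<C> \<Longrightarrow> partial_character H \<and> G \<subseteq> H"
      and chain: "\<And>H H'. H \<in> \<C> \<Longrightarrow> H' \<in> \<C> \<Longrightarrow> H \<subseteq> H' \<or> H' \<subseteq> H"
      unfolding subset_chain_def \<A>_def by blast+
    \<comment> \<open>Each defining condition concerns at most two pairs, and two pairs always lie
      in one member of the chain.\<close>
    have two: "\<exists>H\<in>\<C>. p \<in> H \<and> q \<in> H" if "p \<in> \<Union>\<C>" "q \<in> \<Union>\<C>" for p q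
      using that chain by blast
    have "partial_character (\<Union>\<C>)"
      unfolding partial_character_def
    proof (intro conjI allI impI)
      show "(1, 1) \<in> \<Union>\<C>" using ne sub partial_characterD(1) by blast
    next
      fix s a t b assume "(s, a) \<in> \<Union>\<C>" "(t, b) \<in> \<Union>\<C>"
      then show "(s * t, a * b) \<in> \<Union>\<C>" using two sub partial_characterD(2) by (meson UnionI)
    next
      fix s a assume "(s, a) \<in> \<Union>\<C>"
      then show "cmod a = 1" using sub partial_characterD(3) by blast
    next
      fix s a b assume "(s, a) \<in> \<Union>\<C>" "(s, b) \<in> \<Union>\<C>"
      then show "a = b" using two sub partial_characterD(4) by meson
    qed
    then show "\<Union>\<C> \<in> \<A>" using ne sub unfolding \<A>_def by blast
  qed
  then obtain M where "M \<in> \<A>" and Mmax: "\<forall>H\<in>\<A>. M \<subseteq> H \<longrightarrow> H = M" by (rule bexE)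
  then have M: "partial_character M" "G \<subseteq> M" unfolding \<A>_def by auto
  have max: "H = M" if "partial_character H" "M \<subseteq> H" for H
  proof -
    have "H \<in> \<A>" using that M(2) unfolding \<A>_def by auto
    then show ?thesis using Mmax that(2) by simp
  qed
  have "\<exists>w. (s, w) \<in> M" for s
  proof -
    obtain H w where "partial_character H" "M \<subseteq> H" "(s, w) \<in> H"
      using partial_character_extend[OF cancel M(1)] by blast
    then show ?thesis using max[of H] by auto
  qed
  then obtain \<theta> where \<theta>: "\<And>s. (s, \<theta> s) \<in> M" by metis
  note D = partial_characterD[OF M(1)]
  have "\<theta> (s * t) = \<theta> s * \<theta> t" for s t using \<theta> D(2)[of s "\<theta> s" t "\<theta> t"] D(4)[of "s * t"] by simp
  moreover have "cmod (\<theta> s) = 1" for s using \<theta> D(3) by blast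
  ultimately have "\<theta> \<in> characters"
    unfolding characters_def semicharacters_def by (auto intro!: exI[of _ 1]) (metis norm_zero zero_neq_one)
  moreover have "\<theta> s = a" if "(s, a) \<in> G" for s a using that M(2) \<theta> D(4) by blast
  ultimately show thesis using that by blast
qed

section \<open>Semicharacters and their powers\<close>

lemma semicharacterD:
  assumes "\<psi> \<in> semicharacters"
  shows "\<psi> (s * t) = \<psi> s * \<psi> t" "cmod (\<psi> s) \<le> 1" "\<psi> 1 = 1"
proof -
  show mult: "\<psi> (s * t) = \<psi> s * \<psi> t" and "cmod (\<psi> s) \<le> 1" for s t
    using assms unfolding semicharacters_def by auto
  obtain r where "\<psi> r \<noteq> 0" using assms unfolding semicharacters_def by auto
  then show "\<psi> 1 = 1" using mult[of r 1] by simp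
qed

lemma semicharacterI:
  assumes "\<And>s t. \<psi> (s * t) = \<psi> s * \<psi> t" "\<And>s. cmod (\<psi> s) \<le> 1" "\<psi> 1 = 1"
  shows "\<psi> \<in> semicharacters"
  unfolding semicharacters_def using assms by (auto intro!: exI[of _ 1])

lemma characterD:
  assumes "\<theta> \<in> characters"
  shows "\<theta> \<in> semicharacters" "cmod (\<theta> s) = 1"
  using assms unfolding characters_def by auto

lemma semicharacter_mult:
  assumes "\<psi> \<in> semicharacters" "\<phi> \<in> semicharacters"
  shows "\<psi> * \<phi> \<in> semicharacters"
  using assms by (intro semicharacterI) (auto simp: semicharacterD norm_mult mult_le_one)

lemma character_mult:
  assumes "\<psi> \<in> characters" "\<phi> \<in> characters"
  shows "\<psi> * \<phi> \<in> characters"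
  using assms semicharacter_mult[of \<psi> \<phi>] unfolding characters_def by (auto simp: norm_mult)

lemma one_character: "1 \<in> characters"
  unfolding characters_def by (auto intro!: semicharacterI)

lemma cnj_character:
  assumes "\<theta> \<in> characters"
  shows "cnj \<circ> \<theta> \<in> characters" "\<theta> * (cnj \<circ> \<theta>) = 1" "(cnj \<circ> \<theta>) * \<theta> = 1"
proof -
  show "cnj \<circ> \<theta> \<in> characters"
    using characterD[OF assms] semicharacterD[OF characterD(1)[OF assms]]
    unfolding characters_def by (auto intro!: semicharacterI)
  show "\<theta> * (cnj \<circ> \<theta>) = 1"
    using characterD(2)[OF assms] by (auto simp: fun_eq_iff complex_norm_square[symmetric])
  then show "(cnj \<circ> \<theta>) * \<theta> = 1" by (simp add: mult.commute)
qed

text \<open>The non-characters form an ideal: a value inside the open disc stays there after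
  multiplication by a number of modulus at most 1. This keeps translated points where analyticity is
  demanded.\<close>

lemma mult_not_character:
  assumes "\<psi> \<in> semicharacters - characters" "\<phi> \<in> semicharacters"
  shows "\<psi> * \<phi> \<in> semicharacters - characters"
proof -
  obtain s where "cmod (\<psi> s) \<noteq> 1" using assms unfolding characters_def by auto
  then have "cmod (\<psi> s) < 1" using semicharacterD(2)[of \<psi> s] assms by auto
  then have "cmod ((\<psi> * \<phi>) s) < 1"
    using semicharacterD(2)[OF assms(2), of s]
    by (simp add: norm_mult) (metis mult_left_le norm_ge_zero order_le_less_trans)
  then show ?thesis
    using semicharacter_mult[of \<psi> \<phi>] assms characterD(2)[of "\<psi> * \<phi>" s] by auto
qed

lemma nonneg_semicharacter_cases:
  assumes "\<rho> \<in> nonneg_semicharacters"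
  obtains r where "\<rho> s = complex_of_real r" "0 \<le> r" "r \<le> 1"
proof -
  have "0 \<le> \<rho> s" "cmod (\<rho> s) \<le> 1"
    using assms semicharacterD(2) unfolding nonneg_semicharacters_def by auto
  moreover have "\<rho> s = complex_of_real (Re (\<rho> s))"
    using \<open>0 \<le> \<rho> s\<close> by (simp add: complex_eq_iff less_eq_complex_def)
  moreover have "0 \<le> Re (\<rho> s)" "Re (\<rho> s) \<le> 1"
    using \<open>0 \<le> \<rho> s\<close> \<open>cmod (\<rho> s) \<le> 1\<close> complex_Re_le_cmod[of "\<rho> s"]
    by (auto simp: less_eq_complex_def)
  ultimately show thesis using that by blast
qed

text \<open>The boundary \<open>Re z = 0\<close> is included because imaginary powers of a strictly
  positive semicharacter serve as characters later.\<close>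

lemma cpower_semicharacter:
  assumes \<rho>: "\<rho> \<in> nonneg_semicharacters" and z: "0 \<le> Re z"
  shows "cpower \<rho> z \<in> semicharacters"
proof (rule semicharacterI)
  have sc: "\<rho> \<in> semicharacters" using \<rho> unfolding nonneg_semicharacters_def by auto
  fix s t
  obtain a where a: "\<rho> s = complex_of_real a" "0 \<le> a" "a \<le> 1"
    using nonneg_semicharacter_cases[OF \<rho>] by blast
  obtain b where b: "\<rho> t = complex_of_real b" "0 \<le> b" "b \<le> 1"
    using nonneg_semicharacter_cases[OF \<rho>] by blast
  show "cpower \<rho> z (s * t) = cpower \<rho> z s * cpower \<rho> z t"
    unfolding cpower_def semicharacterD(1)[OF sc] a(1) b(1)
    by (rule powr_times_real) (use a b in auto)
  show "cmod (cpower \<rho> z s) \<le> 1"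
    unfolding cpower_def a(1) using a z by (simp add: norm_powr_real_powr powr_le1)
  show "cpower \<rho> z 1 = 1" unfolding cpower_def semicharacterD(3)[OF sc] by simp
qed

lemma cpower_not_character:
  assumes \<rho>: "\<rho> \<in> nonneg_semicharacters" "\<rho> \<notin> characters" and z: "0 < Re z"
  shows "cpower \<rho> z \<in> semicharacters - characters"
proof -
  obtain s where s: "cmod (\<rho> s) \<noteq> 1"
    using \<rho> unfolding characters_def nonneg_semicharacters_def by auto
  obtain a where a: "\<rho> s = complex_of_real a" "0 \<le> a" "a \<le> 1"
    using nonneg_semicharacter_cases[OF \<rho>(1)] by blast
  have "cmod (cpower \<rho> z s) = a powr Re z"
    unfolding cpower_def a(1) using a by (simp add: norm_powr_real_powr)
  moreover have "a < 1" using s a by auto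
  then have "a powr Re z < 1" using powr_less_mono2[of "Re z" a 1] z a by simp
  ultimately have "cpower \<rho> z \<notin> characters" using characterD(2)[of "cpower \<rho> z" s] by auto
  then show ?thesis using cpower_semicharacter[of \<rho> z] \<rho> z by auto
qed

lemma cpower_add: "cpower \<rho> (z + w) = cpower \<rho> z * cpower \<rho> w"
  by (simp add: cpower_def fun_eq_iff powr_add)

lemma cpower_1: "\<rho> \<in> nonneg_semicharacters \<Longrightarrow> cpower \<rho> 1 = \<rho>"
  unfolding cpower_def by (auto simp: fun_eq_iff powr_def exp_Ln)

section \<open>Idempotents, moduli and polar decomposition\<close>

lemma idempotent_semicharacter_iff:
  "\<rho> \<in> idempotent_semicharacters \<longleftrightarrow> \<rho> \<in> semicharacters \<and> (\<forall>s. \<rho> s = 0 \<or> \<rho> s = 1)"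
  unfolding idempotent_semicharacters_def by (auto simp: fun_eq_iff)

definition modulus :: "('a \<Rightarrow> complex) \<Rightarrow> 'a \<Rightarrow> complex" where
  "modulus \<psi> = (\<lambda>s. complex_of_real (cmod (\<psi> s)))"

lemma modulus_nonneg_semicharacter:
  assumes "\<psi> \<in> semicharacters"
  shows "modulus \<psi> \<in> nonneg_semicharacters"
  using semicharacterD[OF assms] unfolding nonneg_semicharacters_def modulus_def
  by (auto intro!: semicharacterI simp: norm_mult less_eq_complex_def)

lemma modulus_idempotent_mult_character:
  assumes "\<rho> \<in> idempotent_semicharacters" "\<theta> \<in> characters"
  shows "modulus (\<rho> * \<theta>) = \<rho>"
proof
  fix s
  have "\<rho> s = 0 \<or> \<rho> s = 1" using assms(1) unfolding idempotent_semicharacter_iff by blast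
  then show "modulus (\<rho> * \<theta>) s = \<rho> s"
    using characterD(2)[OF assms(2)] by (auto simp: modulus_def norm_mult)
qed

text \<open>The support of \<open>\<psi>\<close> is closed under products and \<open>sgn\<close> is
  multiplicative, so the phases form a partial character. Its extension may take any values at the
  zeros of \<open>\<psi>\<close>, because \<open>modulus \<psi>\<close> vanishes there.\<close>

lemma polar_decomposition:
  fixes \<psi> :: "'a::comm_monoid_mult \<Rightarrow> complex"
  assumes cancel: "\<forall>a b c :: 'a. a * b = a * c \<longrightarrow> b = c" and \<psi>: "\<psi> \<in> semicharacters"
  obtains \<theta> where "\<theta> \<in> characters" "\<psi> = modulus \<psi> * \<theta>"
proof -
  note D = semicharacterD[OF \<psi>]
  define G where "G = {(s, sgn (\<psi> s)) | s. \<psi> s \<noteq> 0}"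
  have "partial_character G"
    unfolding partial_character_def G_def using D by (auto simp: sgn_mult norm_sgn)
  then obtain \<theta> where \<theta>: "\<theta> \<in> characters" "\<And>s a. (s, a) \<in> G \<Longrightarrow> \<theta> s = a"
    using partial_character_extends_to_character[OF cancel] by blast
  have "\<psi> s = modulus \<psi> s * \<theta> s" for s
  proof (cases "\<psi> s = 0")
    case False
    then have "\<theta> s = sgn (\<psi> s)" using \<theta>(2) unfolding G_def by blast
    then show ?thesis using False by (simp add: modulus_def complex_sgn_def scaleR_conv_of_real sgn_div_norm)
  qed (simp add: modulus_def)
  then show thesis using \<theta>(1) that by (auto simp: fun_eq_iff)
qed

section \<open>Maximal subgroups\<close>

text \<open>An element \<open>g\<close> of any subgroup through \<open>\<rho>\<close> satisfies
  \<open>g * \<rho> = g\<close> and \<open>g * h = \<rho>\<close> for some \<open>h\<close>. The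
  first makes \<open>g\<close> vanish where \<open>\<rho>\<close> does, the second forces modulus 1
  elsewhere, both factors being bounded by 1. So \<open>modulus g = \<rho>\<close>, and the polar
  decomposition puts \<open>g\<close> into the coset.\<close>

lemma maximal_subgroup_coset:
  fixes \<rho> :: "'a::comm_monoid_mult \<Rightarrow> complex"
  assumes cancel: "\<forall>a b c :: 'a. a * b = a * c \<longrightarrow> b = c"
    and \<rho>: "\<rho> \<in> idempotent_semicharacters"
  shows "is_maximal_subgroup \<rho> ((\<lambda>\<phi>. \<rho> * \<phi>) ` characters)" (is "is_maximal_subgroup \<rho> ?H")
proof -
  have \<rho>s: "\<rho> \<in> semicharacters" and idem: "\<rho> * \<rho> = \<rho>"
    using \<rho> unfolding idempotent_semicharacters_def by auto
  have prod: "(\<rho> * \<phi>) * (\<rho> * \<phi>') = \<rho> * (\<phi> * \<phi>')" for \<phi> \<phi>'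
    using idem by (metis mult.assoc mult.left_commute)
  let ?G = "\<lparr>carrier = ?H, monoid.mult = (*), one = \<rho>\<rparr>"
  have "group ?G"
  proof (rule groupI)
    fix x y assume "x \<in> carrier ?G" "y \<in> carrier ?G"
    then obtain \<phi> \<phi>' where "\<phi> \<in> characters" "x = \<rho> * \<phi>" "\<phi>' \<in> characters" "y = \<rho> * \<phi>'" by auto
    then show "x \<otimes>\<^bsub>?G\<^esub> y \<in> carrier ?G" by (simp add: prod imageI character_mult)
  next
    show "\<one>\<^bsub>?G\<^esub> \<in> carrier ?G" using one_character by (auto intro!: image_eqI[of _ _ 1])
  next
    fix x y z assume "x \<in> carrier ?G" "y \<in> carrier ?G" "z \<in> carrier ?G"
    show "(x \<otimes>\<^bsub>?G\<^esub> y) \<otimes>\<^bsub>?G\<^esub> z = x \<otimes>\<^bsub>?G\<^esub> (y \<otimes>\<^bsub>?G\<^esub> z)" by (simp add: mult.assoc)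
  next
    fix x assume "x \<in> carrier ?G"
    then show "\<one>\<^bsub>?G\<^esub> \<otimes>\<^bsub>?G\<^esub> x = x" using idem by (auto simp flip: mult.assoc)
  next
    fix x assume "x \<in> carrier ?G"
    then obtain \<phi> where \<phi>: "\<phi> \<in> characters" "x = \<rho> * \<phi>" by auto
    then have "(\<rho> * (cnj \<circ> \<phi>)) * x = \<rho>" by (simp only: prod cnj_character(3)[OF \<phi>(1)] mult_1_right)
    then show "\<exists>y\<in>carrier ?G. y \<otimes>\<^bsub>?G\<^esub> x = \<one>\<^bsub>?G\<^esub>" using cnj_character(1)[OF \<phi>(1)] by auto
  qed
  then have "is_subgroup ?H"
    unfolding is_subgroup_def using semicharacter_mult[OF \<rho>s] characterD(1) by auto
  moreover have "\<rho> \<in> ?H" using one_character by (metis imageI mult_1_right)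
  moreover have "K \<subseteq> ?H" if K: "is_subgroup K" "\<rho> \<in> K" for K
  proof
    fix g assume g: "g \<in> K"
    obtain u where grp: "group \<lparr>carrier = K, monoid.mult = (*), one = u\<rparr>" (is "group ?K")
      using K unfolding is_subgroup_def by blast
    interpret group ?K by (rule grp)
    \<comment> \<open>The unit is the only idempotent of a group.\<close>
    have u: "u = \<rho>" using idem \<open>\<rho> \<in> K\<close> l_cancel_one[of \<rho> \<rho>] by simp
    obtain h where h: "h \<in> K" "g * h = \<rho>"
      using r_inv[of g] inv_closed[of g] g u by auto
    have g\<rho>: "g * \<rho> = g" using r_one[of g] g u by simp
    have gs: "g \<in> semicharacters" "h \<in> semicharacters"
      using K g h unfolding is_subgroup_def by auto
    obtain \<theta> where \<theta>: "\<theta> \<in> characters" "g = modulus g * \<theta>"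
      using polar_decomposition[OF cancel gs(1)] by blast
    have "modulus g s = \<rho> s" for s
    proof (cases "\<rho> s = 0")
      case True
      then have "g s = 0" using fun_cong[OF g\<rho>, of s] by simp
      then show ?thesis using True by (simp add: modulus_def)
    next
      case False
      then have "\<rho> s = 1" using \<rho> unfolding idempotent_semicharacter_iff by blast
      then have "cmod (g s) * cmod (h s) = 1"
        using fun_cong[OF h(2), of s] by (simp flip: norm_mult)
      then have "cmod (g s) = 1"
        using semicharacterD(2)[OF gs(1), of s] semicharacterD(2)[OF gs(2), of s]
        by (metis mult_left_le norm_ge_zero order_antisym)
      then show ?thesis using \<open>\<rho> s = 1\<close> by (simp add: modulus_def)
    qed
    then have "modulus g = \<rho>" by auto
    then show "g \<in> ?H" using \<theta> by auto
  qed
  ultimately show ?thesis unfolding is_maximal_subgroup_def by blast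
qed

section \<open>A maximum principle for bounded functions on a half-plane\<close>

text \<open>A Phragmen-Lindeloef argument: division by \<open>1 + d * (z - a)\<close> makes
  \<open>h\<close> small on large half-circles, so the maximum principle applies on a half-disc;
  then \<open>d\<close> tends to 0. As \<open>a > 0\<close>, the line \<open>Re z = a\<close> lies
  inside the domain of holomorphy.\<close>

lemma bounded_half_plane_max:
  assumes hol: "h holomorphic_on {z. 0 < Re z}" and a: "0 < a" and c: "0 < c"
    and bdd: "\<And>z. 0 < Re z \<Longrightarrow> cmod (h z) \<le> 1"
    and line: "\<And>z. Re z = a \<Longrightarrow> cmod (h z) \<le> c"
    and w: "a \<le> Re w"
  shows "cmod (h w) \<le> c"
proof -
  have one_le: "1 \<le> cmod (1 + of_real d * (z - of_real a))" if "0 < d" "a \<le> Re z" for d z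
  proof -
    have "1 \<le> Re (1 + of_real d * (z - of_real a))" using that by simp
    then show ?thesis using complex_Re_le_cmod order_trans by blast
  qed
  have damped: "cmod (h w) \<le> c * cmod (1 + of_real d * (w - of_real a))" if d: "0 < d" for d
  proof -
    define k where "k z = h z / (1 + of_real d * (z - of_real a))" for z
    \<comment> \<open>The radius puts \<open>w\<close> into the half-disc and makes
      \<open>d * R\<close> at least \<open>1 / c\<close>, which brings the bound 1 for
      \<open>h\<close> down to \<open>c\<close> for \<open>k\<close> on the arc.\<close>
    define R where "R = max (cmod (w - of_real a)) (1 / (d * c)) + 1"
    define S where "S = cball (of_real a) R \<inter> {z. a \<le> Re z}"
    have R: "cmod (w - of_real a) \<le> R" "1 / (d * c) \<le> R" "0 < R"
      unfolding R_def by (auto intro: add_nonneg_pos simp: le_max_iff_disj)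
    have clS: "closed S" unfolding S_def by (intro closed_Int closed_cball closed_halfspace_Re_ge)
    have SRe: "a \<le> Re z" if "z \<in> S" for z using that unfolding S_def by auto
    have nz: "1 + of_real d * (z - of_real a) \<noteq> 0" if "z \<in> S" for z
      using one_le[OF d SRe[OF that]] by auto
    have kS: "k holomorphic_on S"
      unfolding k_def
      by (intro holomorphic_intros holomorphic_on_subset[OF hol] nz) (use SRe a in force)+
    have "cmod (k w) \<le> c"
    proof (rule maximum_modulus_frontier[of k S c w])
      show "k holomorphic_on interior S" using kS interior_subset holomorphic_on_subset by blast
      show "continuous_on (closure S) k"
        using holomorphic_on_imp_continuous_on[OF kS] clS by simp
      show "bounded S" unfolding S_def by (simp add: bounded_Int)
      show "w \<in> S" using R w unfolding S_def by (auto simp: dist_norm norm_minus_commute)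
    next
      fix z assume z: "z \<in> frontier S"
      then have zS: "z \<in> S" using frontier_subset_closed[OF clS] by blast
      have "z \<notin> ball (of_real a) R \<inter> {z. a < Re z}"
      proof
        assume "z \<in> ball (of_real a) R \<inter> {z. a < Re z}"
        moreover have "open (ball (of_real a) R \<inter> {z. a < Re z})"
          by (intro open_Int open_ball open_halfspace_Re_gt)
        moreover have "ball (of_real a) R \<inter> {z. a < Re z} \<subseteq> S" unfolding S_def by auto
        ultimately have "z \<in> interior S" by (meson interiorI)
        then show False using z unfolding frontier_def by auto
      qed
      then consider "Re z = a" | "cmod (z - of_real a) = R"
        using zS unfolding S_def by (force simp: dist_norm norm_minus_commute)
      then show "cmod (k z) \<le> c"
      proof cases
        case 1
        have "cmod (k z) \<le> cmod (h z) / 1"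
          unfolding k_def norm_divide using one_le[OF d SRe[OF zS]] by (intro divide_left_mono) auto
        then show ?thesis using line[OF 1] by simp
      next
        case 2
        have "d * R \<le> cmod (1 + of_real d * (z - of_real a))"
        proof -
          have "(d * R)\<^sup>2 = cmod (of_real d * (z - of_real a)) ^ 2"
            using 2 d by (simp add: norm_mult)
          \<comment> \<open>The cross term \<open>2 * d * Re (z - a)\<close> is nonnegative.\<close>
          also have "\<dots> \<le> cmod (1 + of_real d * (z - of_real a)) ^ 2"
            using d SRe[OF zS] unfolding cmod_power2 by (simp add: power2_sum)
          finally show ?thesis by (rule power2_le_imp_le) simp
        qed
        moreover have "1 / c \<le> d * R" using R(2) d c by (simp add: field_simps)
        ultimately have "1 / c \<le> cmod (1 + of_real d * (z - of_real a))" by simp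
        then have "1 \<le> c * cmod (1 + of_real d * (z - of_real a))"
          using c by (simp add: field_simps)
        moreover have "cmod (h z) \<le> 1" using bdd SRe[OF zS] a by simp
        ultimately have "cmod (h z) \<le> c * cmod (1 + of_real d * (z - of_real a))" by simp
        then show ?thesis
          unfolding k_def norm_divide using nz[OF zS] by (simp add: divide_le_eq)
      qed
    qed
    then show ?thesis
      unfolding k_def norm_divide using one_le[OF d w] by (auto simp: divide_le_eq split: if_splits)
  qed
  have "((\<lambda>d. c * cmod (1 + of_real d * (w - of_real a))) \<longlongrightarrow> c * cmod (1 + of_real 0 * (w - of_real a))) (at_right 0)"
    by (intro tendsto_intros)
  then have "((\<lambda>d. c * cmod (1 + of_real d * (w - of_real a))) \<longlongrightarrow> c) (at_right 0)" by simp
  moreover have "\<forall>\<^sub>F d in at_right 0. cmod (h w) \<le> c * cmod (1 + of_real d * (w - of_real a))"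
    using eventually_at_right_less[of "0::real"] by eventually_elim (rule damped)
  ultimately show ?thesis by (rule tendsto_lowerbound) simp
qed

section \<open>The topology of pointwise convergence\<close>

lemma tendsto_fun_coordinatewise:
  fixes g :: "'b \<Rightarrow> 'a \<Rightarrow> 'c::topological_space"
  assumes "\<And>s. ((\<lambda>x. g x s) \<longlongrightarrow> l s) F"
  shows "(g \<longlongrightarrow> l) F"
proof -
  have "limitin (product_topology (\<lambda>i::'a. euclidean::'c topology) UNIV) g l F"
    unfolding limitin_componentwise using assms by (auto simp: extensional_def)
  then show ?thesis unfolding euclidean_product_topology by simp
qed

lemma closed_characters: "closed (characters :: ('a::comm_monoid_mult \<Rightarrow> complex) set)"
proof -
  \<comment> \<open>Non-vanishing is implied by modulus 1, so all conditions become equations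
    between continuous functions.\<close>
  have eq: "characters = (\<Inter>s. \<Inter>t. {\<psi> :: 'a \<Rightarrow> complex. \<psi> (s * t) = \<psi> s * \<psi> t}) \<inter> (\<Inter>s. {\<psi>. cmod (\<psi> s) = 1})"
    unfolding characters_def semicharacters_def by (auto, metis norm_zero zero_neq_one)
  have "closed {\<psi> :: 'a \<Rightarrow> complex. \<psi> (s * t) = \<psi> s * \<psi> t}" for s t
    by (intro closed_Collect_eq continuous_on_mult continuous_on_product_coordinates)
  moreover have "closed {\<psi> :: 'a \<Rightarrow> complex. cmod (\<psi> s) = 1}" for s
    by (intro closed_Collect_eq continuous_on_norm continuous_on_product_coordinates continuous_on_const)
  ultimately show ?thesis unfolding eq by (intro closed_Int closed_INT ballI)
qed

text \<open>Tychonoff's theorem for a product of circles, in which the characters form a closed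
  set.\<close>

lemma compact_characters: "compact (characters :: ('a::comm_monoid_mult \<Rightarrow> complex) set)"
proof -
  have "compactin (product_topology (\<lambda>s::'a. euclidean :: complex topology) UNIV) (PiE UNIV (\<lambda>_. sphere 0 1))"
    unfolding compactin_PiE by simp
  then have "compact (PiE (UNIV :: 'a set) (\<lambda>_. sphere (0::complex) 1))"
    unfolding euclidean_product_topology by simp
  moreover have "characters \<subseteq> PiE (UNIV :: 'a set) (\<lambda>_. sphere (0::complex) 1)"
    by (auto simp: characters_def)
  ultimately show ?thesis
    using closed_characters by (metis compact_Int_closed inf.absorb_iff2)
qed

section \<open>Generalized analytic functions\<close>

lemma gen_analytic_algebraD:
  assumes "f \<in> gen_analytic_algebra"
  shows "continuous_on semicharacters f"
    and "\<rho> \<in> nonneg_semicharacters \<Longrightarrow> \<rho> \<notin> characters \<Longrightarrow> \<psi> \<in> semicharacters - characters \<Longrightarrow>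
      (\<lambda>z. f (cpower \<rho> z * \<psi>)) holomorphic_on {z. 0 < Re z}"
  using assms analytic_imp_holomorphic
  unfolding gen_analytic_algebra_def generalized_analytic_def nonneg_semicharacters_def by auto

lemma peak_function_le_1:
  assumes "P \<subseteq> Y" "\<forall>y\<in>P. f y = 1" "\<forall>y\<in>Y - P. cmod (f y) < 1" "y \<in> Y"
  shows "cmod (f y) \<le> 1"
  using assms by (cases "y \<in> P") (auto simp: less_imp_le)

section \<open>Invariance under translation by characters\<close>

lemma gen_analytic_translate:
  assumes f: "f \<in> gen_analytic_algebra" and \<theta>: "\<theta> \<in> characters"
  shows "(\<lambda>\<psi>. f (\<theta> * \<psi>)) \<in> gen_analytic_algebra"
proof -
  have "continuous_on semicharacters (\<lambda>\<psi>. f (\<theta> * \<psi>))"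
  proof (rule continuous_on_compose2[OF gen_analytic_algebraD(1)[OF f]])
    show "continuous_on semicharacters (\<lambda>\<psi>. \<theta> * \<psi>)"
      unfolding times_fun_def
      by (intro continuous_intros continuous_on_subset[OF continuous_on_product_coordinates]) auto
    show "(\<lambda>\<psi>. \<theta> * \<psi>) ` semicharacters \<subseteq> semicharacters"
      using semicharacter_mult characterD(1)[OF \<theta>] by blast
  qed
  moreover have "generalized_analytic (\<lambda>\<psi>. f (\<theta> * \<psi>))"
    unfolding generalized_analytic_def
  proof (intro ballI impI)
    fix \<rho> \<psi> :: "'a \<Rightarrow> complex"
    assume A: "\<rho> \<in> semicharacters - characters" "\<psi> \<in> semicharacters - characters" "\<forall>s. 0 \<le> \<rho> s"
    \<comment> \<open>The factor \<open>\<theta>\<close> is moved into the base point, which remains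
      a non-character.\<close>
    have "\<psi> * \<theta> \<in> semicharacters - characters"
      using mult_not_character[OF A(2) characterD(1)[OF \<theta>]] .
    moreover have "f (\<theta> * (cpower \<rho> z * \<psi>)) = f (cpower \<rho> z * (\<psi> * \<theta>))" for z
      by (simp add: mult_ac)
    ultimately show "(\<lambda>z. f (\<theta> * (cpower \<rho> z * \<psi>))) analytic_on {z. 0 < Re z} \<and>
      ((\<lambda>t::real. f (\<theta> * (cpower \<rho> (of_real t) * \<psi>))) \<longlongrightarrow> f (\<theta> * (cpower \<rho> 0 * \<psi>))) (at_right 0)"
      using f A unfolding gen_analytic_algebra_def generalized_analytic_def by simp
  qed
  ultimately show ?thesis unfolding gen_analytic_algebra_def by blast
qed

lemma peak_set_translate:
  assumes P: "peak_set semicharacters gen_analytic_algebra P" and \<theta>: "\<theta> \<in> characters"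
  shows "peak_set semicharacters gen_analytic_algebra {\<psi> \<in> semicharacters. \<theta> * \<psi> \<in> P}"
proof -
  obtain f where f: "f \<in> gen_analytic_algebra" "\<forall>y\<in>P. f y = 1" "\<forall>y\<in>semicharacters - P. cmod (f y) < 1"
    using P unfolding peak_set_def by blast
  then show ?thesis
    unfolding peak_set_def
    using gen_analytic_translate[OF f(1) \<theta>] semicharacter_mult[OF characterD(1)[OF \<theta>]]
    by (intro conjI bexI[of _ "\<lambda>\<psi>. f (\<theta> * \<psi>)"]) auto
qed

lemma p_point_translate:
  assumes p: "p_point semicharacters gen_analytic_algebra \<psi>" and \<theta>: "\<theta> \<in> characters"
  shows "p_point semicharacters gen_analytic_algebra (\<psi> * \<theta>)"
proof -
  obtain \<P> where \<P>: "\<P> \<noteq> {}" "\<And>P. P \<in> \<P> \<Longrightarrow> peak_set semicharacters gen_analytic_algebra P" "\<Inter>\<P> = {\<psi>}"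
    and \<psi>: "\<psi> \<in> semicharacters" using p unfolding p_point_def by blast
  \<comment> \<open>Multiplication by \<open>cnj \<circ> \<theta>\<close> inverts multiplication by
    \<open>\<theta>\<close>, so these preimages are the peak sets translated by
    \<open>\<theta>\<close>.\<close>
  define \<Q> where "\<Q> = (\<lambda>P. {\<phi> \<in> semicharacters. (cnj \<circ> \<theta>) * \<phi> \<in> P}) ` \<P>"
  note c = cnj_character[OF \<theta>]
  have s: "\<psi> * \<theta> \<in> semicharacters" using semicharacter_mult \<psi> characterD(1)[OF \<theta>] by blast
  have "\<phi> \<in> \<Inter>\<Q> \<longleftrightarrow> \<phi> = \<psi> * \<theta>" for \<phi>
  proof -
    have "\<phi> \<in> \<Inter>\<Q> \<longleftrightarrow> \<phi> \<in> semicharacters \<and> (cnj \<circ> \<theta>) * \<phi> \<in> \<Inter>\<P>"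
      unfolding \<Q>_def using \<P>(1) by auto
    also have "\<dots> \<longleftrightarrow> \<phi> \<in> semicharacters \<and> (cnj \<circ> \<theta>) * \<phi> = \<psi>" using \<P>(3) by simp
    also have "(cnj \<circ> \<theta>) * \<phi> = \<psi> \<longleftrightarrow> \<phi> = \<psi> * \<theta>"
    proof
      assume "(cnj \<circ> \<theta>) * \<phi> = \<psi>"
      then have "\<psi> * \<theta> = (\<theta> * (cnj \<circ> \<theta>)) * \<phi>" by (metis mult.assoc mult.commute)
      then show "\<phi> = \<psi> * \<theta>" using c by simp
    next
      assume "\<phi> = \<psi> * \<theta>"
      then have "(cnj \<circ> \<theta>) * \<phi> = \<psi> * (\<theta> * (cnj \<circ> \<theta>))" by (metis mult.assoc mult.commute)
      then show "(cnj \<circ> \<theta>) * \<phi> = \<psi>" using c by simp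
    qed
    finally show ?thesis using s by blast
  qed
  then have "\<Inter>\<Q> = {\<psi> * \<theta>}" by blast
  moreover have "\<Q> \<noteq> {}" using \<P>(1) unfolding \<Q>_def by simp
  moreover have "peak_set semicharacters gen_analytic_algebra Q" if "Q \<in> \<Q>" for Q
    using that peak_set_translate[OF \<P>(2) c(1)] unfolding \<Q>_def by auto
  ultimately show ?thesis unfolding p_point_def using s by blast
qed

section \<open>Points of the strong boundary\<close>

text \<open>The map \<open>(1 + z) / 2\<close> sends the closed unit disc into itself and reaches
  the unit circle only at 1. Along \<open>cpower \<rho> z * \<psi>\<close> the evaluation at
  \<open>s\<close> is a constant times an exponential in \<open>z\<close>, or 0.\<close>

lemma evaluation_peak_set:
  "peak_set semicharacters gen_analytic_algebra {\<psi> \<in> semicharacters. \<psi> s = 1}"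
proof -
  define f where "f \<psi> = (1 + \<psi> s) / 2" for \<psi> :: "'a \<Rightarrow> complex"
  have "continuous_on semicharacters f"
    unfolding f_def
    by (intro continuous_intros continuous_on_subset[OF continuous_on_product_coordinates]) auto
  moreover have "generalized_analytic f"
    unfolding generalized_analytic_def
  proof (intro ballI impI conjI)
    fix \<rho> \<psi> :: "'a \<Rightarrow> complex"
    assume "\<rho> \<in> semicharacters - characters" "\<forall>s. 0 \<le> \<rho> s"
    then obtain a where a: "\<rho> s = complex_of_real a" "0 \<le> a"
      using nonneg_semicharacter_cases[of \<rho>] unfolding nonneg_semicharacters_def by blast
    show "(\<lambda>z. f (cpower \<rho> z * \<psi>)) analytic_on {z. 0 < Re z}"
      unfolding analytic_on_open[OF open_halfspace_Re_gt] f_def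
      by (cases "\<rho> s = 0") (auto simp: cpower_def intro!: holomorphic_intros)
    show "((\<lambda>t::real. f (cpower \<rho> (of_real t) * \<psi>)) \<longlongrightarrow> f (cpower \<rho> 0 * \<psi>)) (at_right 0)"
    \<comment> \<open>At a zero of \<open>\<rho>\<close> nothing jumps, since
      \<open>0 powr 0 = 0\<close>.\<close>
    proof (cases "a = 0")
      case False
      have "((\<lambda>t. complex_of_real (a powr t)) \<longlongrightarrow> complex_of_real (a powr 0)) (at_right 0)"
        using False a by (intro tendsto_intros) auto
      then have "((\<lambda>t::real. cpower \<rho> (of_real t) s) \<longlongrightarrow> cpower \<rho> 0 s) (at_right 0)"
        using False a unfolding cpower_def a(1) by (simp add: powr_of_real)
      then show ?thesis unfolding f_def times_fun_apply by (intro tendsto_intros) auto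
    qed (simp add: f_def cpower_def a)
  qed
  moreover have "cmod (f \<psi>) < 1" if "\<psi> \<in> semicharacters" "\<psi> s \<noteq> 1" for \<psi>
  proof -
    have "cmod (f \<psi>) \<noteq> 1"
    proof
      assume "cmod (f \<psi>) = 1"
      then have "(cmod (1 + \<psi> s))\<^sup>2 = 4" by (simp add: f_def norm_divide)
      then have "1 + 2 * Re (\<psi> s) + (cmod (\<psi> s))\<^sup>2 = 4"
        unfolding cmod_power2 by (simp add: power2_sum)
      moreover have "(cmod (\<psi> s))\<^sup>2 \<le> 1" "Re (\<psi> s) \<le> 1"
        using semicharacterD(2)[OF that(1), of s] complex_Re_le_cmod[of "\<psi> s"]
        by (auto simp: power_le_one)
      ultimately have "Re (\<psi> s) = 1" "(cmod (\<psi> s))\<^sup>2 = 1" by linarith+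
      then have "\<psi> s = 1" unfolding cmod_power2 by (simp add: complex_eq_iff)
      then show False using that by blast
    qed
    moreover have "cmod (f \<psi>) \<le> 1"
      unfolding f_def norm_divide
      using norm_triangle_ineq[of 1 "\<psi> s"] semicharacterD(2)[OF that(1), of s] by simp
    ultimately show ?thesis by simp
  qed
  ultimately show ?thesis
    unfolding peak_set_def gen_analytic_algebra_def
    by (intro conjI bexI[of _ f]) (auto simp: f_def)
qed

lemma one_p_point: "p_point semicharacters gen_analytic_algebra 1"
proof -
  let ?\<P> = "range (\<lambda>s::'a. {\<psi> \<in> semicharacters. \<psi> s = 1})"
  have "\<Inter>?\<P> = {1}"
    using characterD(1)[OF one_character] by (auto simp: fun_eq_iff)
  then show ?thesis
    unfolding p_point_def using evaluation_peak_set characterD(1)[OF one_character]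
    by (intro conjI exI[of _ ?\<P>]) auto
qed

text \<open>
  The modulus \<open>\<rho>\<close> of a semicharacter \<open>\<rho> \<theta>\<close> deforms it analytically: \<open>z \<mapsto> f (\<rho>\<^sup>z \<rho>\<^sup>1\<^sup>/\<^sup>2 \<theta>)\<close> attains the
  maximum \<open>1\<close> of its modulus at the interior point \<open>z = 1/2\<close>.
\<close>

lemma p_point_modulus_idempotent:
  fixes \<psi> :: "'a::comm_monoid_mult \<Rightarrow> complex"
  assumes cancel: "\<forall>a b c :: 'a. a * b = a * c \<longrightarrow> b = c"
    and p: "p_point semicharacters gen_analytic_algebra \<psi>"
  shows "modulus \<psi> \<in> idempotent_semicharacters"
proof (cases "\<psi> \<in> characters")
  case True
  then have "modulus \<psi> = 1" by (auto simp: modulus_def characterD(2))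
  then show ?thesis using characterD(1)[OF one_character] by (simp add: idempotent_semicharacters_def)
next
  case False
  obtain \<P> where \<P>: "\<And>P. P \<in> \<P> \<Longrightarrow> peak_set semicharacters gen_analytic_algebra P" "\<Inter>\<P> = {\<psi>}"
    and \<psi>: "\<psi> \<in> semicharacters" using p unfolding p_point_def by blast
  define \<rho> where "\<rho> = modulus \<psi>"
  obtain \<theta> where \<theta>: "\<theta> \<in> characters" "\<psi> = \<rho> * \<theta>"
    using polar_decomposition[OF cancel \<psi>] unfolding \<rho>_def by blast
  have \<rho>: "\<rho> \<in> nonneg_semicharacters" unfolding \<rho>_def by (rule modulus_nonneg_semicharacter[OF \<psi>])
  have \<rho>nc: "\<rho> \<notin> characters" using \<theta> False character_mult by blast
  \<comment> \<open>The base point cannot be \<open>\<theta>\<close> itself, as analyticity is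
    demanded only at non-characters. Half of the modulus is therefore put into the base point, and
    \<open>\<psi>\<close> sits at the interior parameter \<open>1/2\<close>.\<close>
  define \<psi>' where "\<psi>' = cpower \<rho> (1/2) * \<theta>"
  have \<psi>': "\<psi>' \<in> semicharacters - characters"
    unfolding \<psi>'_def
    by (intro mult_not_character cpower_not_character \<rho> \<rho>nc characterD(1)[OF \<theta>(1)]) simp
  have half: "cpower \<rho> (1/2) * \<psi>' = \<psi>"
    unfolding \<psi>'_def \<theta>(2) by (simp flip: mult.assoc cpower_add add: cpower_1[OF \<rho>])
  have in_sc: "cpower \<rho> z * \<psi>' \<in> semicharacters" if "0 < Re z" for z
    using that \<psi>' cpower_semicharacter[OF \<rho>] by (intro semicharacter_mult) auto
  \<comment> \<open>This is the point at the parameter \<open>z = 1\<close>, where the modulus has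
    the exponent \<open>3/2\<close>. Lying in every peak set of the family, it equals
    \<open>\<psi>\<close>, so each value \<open>r\<close> of \<open>\<rho>\<close> satisfies
    \<open>r powr (3/2) = r\<close>.\<close>
  have "\<rho> * \<psi>' \<in> P" if PP: "P \<in> \<P>" for P
  proof (rule ccontr)
    assume nP: "\<rho> * \<psi>' \<notin> P"
    obtain f where f: "f \<in> gen_analytic_algebra" and fP: "P \<subseteq> semicharacters"
      "\<forall>y\<in>P. f y = 1" "\<forall>y\<in>semicharacters - P. cmod (f y) < 1"
      using \<P>(1)[OF PP] unfolding peak_set_def by blast
    define g where "g z = f (cpower \<rho> z * \<psi>')" for z
    have "\<psi> \<in> P" using \<P>(2) PP by blast
    then have g_half: "g (1/2) = 1" unfolding g_def half using fP by blast
    have "g constant_on {z. 0 < Re z}"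
    proof (rule maximum_modulus_principle[where U = "{z. 0 < Re z}" and \<xi> = "1/2"])
      show "g holomorphic_on {z. 0 < Re z}"
        unfolding g_def by (rule gen_analytic_algebraD(2)[OF f \<rho> \<rho>nc \<psi>'])
      show "connected {z. 0 < Re z}"
        by (intro convex_connected convex_halfspace_Re_gt)
      show "cmod (g z) \<le> cmod (g (1/2))" if "z \<in> {z. 0 < Re z}" for z
        using peak_function_le_1[OF fP in_sc] that g_half unfolding g_def by simp
    qed (auto simp: open_halfspace_Re_gt)
    then obtain c where c: "\<And>z. 0 < Re z \<Longrightarrow> g z = c" unfolding constant_on_def by auto
    have "g 1 = 1" using c[of 1] c[of "1/2"] g_half by simp
    then have "f (\<rho> * \<psi>') = 1" unfolding g_def cpower_1[OF \<rho>] .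
    moreover have "\<rho> * \<psi>' \<in> semicharacters" using in_sc[of 1] cpower_1[OF \<rho>] by simp
    ultimately show False using fP(3) nP by (metis DiffI less_irrefl norm_one)
  qed
  then have eq: "\<rho> * \<psi>' = \<psi>" using \<P>(2) by blast
  have "\<rho> s = 0 \<or> \<rho> s = 1" for s
  proof -
    obtain r where r: "\<rho> s = complex_of_real r" "0 \<le> r"
      using nonneg_semicharacter_cases[OF \<rho>] by blast
    have "\<rho> s * \<rho> s powr (1/2) * \<theta> s = \<rho> s * \<theta> s"
      using fun_cong[OF eq, of s] unfolding \<theta>(2) \<psi>'_def by (simp add: cpower_def mult.assoc)
    moreover have "\<theta> s \<noteq> 0" using characterD(2)[OF \<theta>(1), of s] by auto
    ultimately have "\<rho> s = 0 \<or> \<rho> s powr (1/2) = 1" by auto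
    moreover have "\<rho> s powr (1/2) * \<rho> s powr (1/2) = \<rho> s"
      by (simp flip: powr_add)
    ultimately show ?thesis by auto
  qed
  then show ?thesis
    using \<rho> unfolding \<rho>_def[symmetric] idempotent_semicharacter_iff nonneg_semicharacters_def by blast
qed

section \<open>Exclusion of \<open>E0_semicharacters\<close> from the strong boundary\<close>

text \<open>
  The orbit \<open>{\<rho>\<^sub>1\<^sup>i\<^sup>y}\<close> is relatively compact in the group of characters. If \<open>Re f \<rho>\<^sub>1 < 1\<close>, then finitely
  many translates of \<open>y \<mapsto> 1 - Re f (\<rho>\<^sub>1\<^sup>1\<^sup>+\<^sup>i\<^sup>y)\<close> have a sum bounded away from \<open>0\<close>, and by the maximum principle
  for the exponential of this sum the bound persists in the half-plane to the right, although \<open>f\<close> tends to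
  \<open>f \<rho>\<^sub>0 = 1\<close> there.
\<close>

lemma E0_peak_function:
  assumes f: "f \<in> gen_analytic_algebra" and le1: "\<And>\<psi>. \<psi> \<in> semicharacters \<Longrightarrow> cmod (f \<psi>) \<le> 1"
    and \<rho>0: "\<rho>\<^sub>0 \<in> idempotent_semicharacters" "f \<rho>\<^sub>0 = 1"
    and \<rho>1: "\<rho>\<^sub>1 \<in> nonneg_semicharacters" "\<rho>\<^sub>1 \<notin> characters"
      "\<And>s. s \<in> pos_set \<rho>\<^sub>0 \<Longrightarrow> \<rho>\<^sub>1 s = 1" "\<And>s. s \<notin> pos_set \<rho>\<^sub>0 \<Longrightarrow> 0 < \<rho>\<^sub>1 s \<and> \<rho>\<^sub>1 s < 1"
  shows "f \<rho>\<^sub>1 = 1"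
proof (rule ccontr)
  assume "f \<rho>\<^sub>1 \<noteq> 1"
  have \<rho>1s: "\<rho>\<^sub>1 \<in> semicharacters" and \<rho>0s: "\<rho>\<^sub>0 \<in> semicharacters"
    using \<rho>1 \<rho>0 unfolding nonneg_semicharacters_def idempotent_semicharacters_def by auto
  note cont = gen_analytic_algebraD(1)[OF f]
  have Re1: "Re (f \<psi>) \<le> 1" if "\<psi> \<in> semicharacters" for \<psi>
    using le1[OF that] complex_Re_le_cmod order_trans by blast
  \<comment> \<open>The only point of the closed unit disc with real part 1 is 1 itself.\<close>
  have "Re (f \<rho>\<^sub>1) < 1"
  proof (rule ccontr)
    assume "\<not> Re (f \<rho>\<^sub>1) < 1"
    then have "Re (f \<rho>\<^sub>1) = 1" using Re1[OF \<rho>1s] by simp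
    moreover have "(cmod (f \<rho>\<^sub>1))\<^sup>2 \<le> 1" using le1[OF \<rho>1s] by (simp add: power_le_one)
    ultimately have "f \<rho>\<^sub>1 = 1" unfolding cmod_power2 by (simp add: complex_eq_iff)
    then show False using \<open>f \<rho>\<^sub>1 \<noteq> 1\<close> by blast
  qed
  define \<epsilon> where "\<epsilon> = (1 - Re (f \<rho>\<^sub>1)) / 2"
  have \<epsilon>: "0 < \<epsilon>" "Re (f \<rho>\<^sub>1) < 1 - \<epsilon>" using \<open>Re (f \<rho>\<^sub>1) < 1\<close> unfolding \<epsilon>_def by (auto simp: field_simps)
  \<comment> \<open>Strict positivity makes the imaginary powers unimodular everywhere, so that they
    form a one-parameter group of characters.\<close>
  have pos: "0 < Re (\<rho>\<^sub>1 s)" "\<rho>\<^sub>1 s = complex_of_real (Re (\<rho>\<^sub>1 s))" for s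
    using \<rho>1(3,4)[of s] by (cases "s \<in> pos_set \<rho>\<^sub>0"; auto simp: less_complex_def complex_eq_iff)+
  define \<theta> where "\<theta> y = cpower \<rho>\<^sub>1 (\<i> * of_real y)" for y
  have norm_\<theta>: "cmod (\<theta> y s) = 1" for y s
    unfolding \<theta>_def cpower_def by (subst pos(2)) (use pos(1)[of s] in \<open>simp add: norm_powr_real_powr\<close>)
  have \<theta>: "\<theta> y \<in> characters" for y
    using cpower_semicharacter[OF \<rho>1(1)] norm_\<theta> unfolding characters_def \<theta>_def by simp
  have \<theta>_inv: "\<theta> y * \<theta> (- y) = 1" for y
  proof -
    have "\<theta> y * \<theta> (- y) = cpower \<rho>\<^sub>1 0" unfolding \<theta>_def by (simp flip: cpower_add)
    moreover have "\<rho>\<^sub>1 s \<noteq> 0" for s using pos(1)[of s] by auto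
    ultimately show ?thesis by (simp add: cpower_def fun_eq_iff)
  qed
  have cnj_\<theta>: "cnj \<circ> \<theta> y = \<theta> (- y)" for y
  proof -
    have "cnj \<circ> \<theta> y = ((cnj \<circ> \<theta> y) * \<theta> y) * \<theta> (- y)" by (simp only: mult.assoc \<theta>_inv mult_1_right)
    then show ?thesis by (simp only: cnj_character(3)[OF \<theta>] mult_1)
  qed
  have mult_cont: "continuous_on characters (\<lambda>\<kappa>. Re (f (\<phi> * h \<kappa>)))"
    if "\<phi> \<in> semicharacters" and "continuous_on characters h" and "h ` characters \<subseteq> characters" for \<phi> h
  proof (rule continuous_on_Re, rule continuous_on_compose2[OF cont])
    show "continuous_on characters (\<lambda>\<kappa>. \<phi> * h \<kappa>)"
      unfolding times_fun_def
      by (intro continuous_on_coordinatewise_then_product continuous_on_mult continuous_on_const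
          continuous_on_product_then_coordinatewise[OF that(2)])
    show "(\<lambda>\<kappa>. \<phi> * h \<kappa>) ` characters \<subseteq> semicharacters"
      using that(3) characterD(1) semicharacter_mult[OF that(1)] by blast
  qed
  have \<rho>\<theta>: "\<rho>\<^sub>1 * \<theta> y \<in> semicharacters" for y using semicharacter_mult[OF \<rho>1s] characterD(1)[OF \<theta>] .
  define C where "C = closure (range \<theta>)"
  have C: "C \<subseteq> characters" unfolding C_def using \<theta> closed_characters by (intro closure_minimal) auto
  then have "compact C"
    using compact_characters closed_closure compact_Int_closed unfolding C_def by (metis inf.absorb_iff2)
  have "\<exists>U. open U \<and> U \<inter> characters = (\<lambda>\<kappa>. Re (f (\<rho>\<^sub>1 * \<theta> (- y) * \<kappa>))) -` {..<1 - \<epsilon>} \<inter> characters" for y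
    using mult_cont[OF \<rho>\<theta> continuous_on_id] unfolding continuous_on_open_invariant by auto
  then obtain U where U: "\<And>y. open (U y)"
    "\<And>y. U y \<inter> characters = (\<lambda>\<kappa>. Re (f (\<rho>\<^sub>1 * \<theta> (- y) * \<kappa>))) -` {..<1 - \<epsilon>} \<inter> characters"
    by metis
  have cover: "C \<subseteq> (\<Union>y\<in>UNIV. U y)"
  proof
    fix \<kappa> assume \<kappa>: "\<kappa> \<in> C"
    then have \<kappa>c: "\<kappa> \<in> characters" using C by blast
    \<comment> \<open>For fixed \<open>\<kappa>\<close> the value at
      \<open>\<alpha> = \<kappa>\<close> is \<open>Re (f \<rho>\<^sub>1)\<close>, which is below
      \<open>1 - \<epsilon>\<close>. By continuity this persists near \<open>\<kappa>\<close>, where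
      some point \<open>\<theta> y\<close> of the orbit lies; that \<open>y\<close> gives
      \<open>\<kappa> \<in> U y\<close>.\<close>
    have "continuous_on characters (\<lambda>\<alpha>. Re (f (\<rho>\<^sub>1 * ((cnj \<circ> \<alpha>) * \<kappa>))))"
    proof (rule mult_cont[OF \<rho>1s])
      show "continuous_on characters (\<lambda>\<alpha>. (cnj \<circ> \<alpha>) * \<kappa>)"
        unfolding times_fun_def comp_def
        by (intro continuous_intros continuous_on_subset[OF continuous_on_product_coordinates]) auto
      show "(\<lambda>\<alpha>. (cnj \<circ> \<alpha>) * \<kappa>) ` characters \<subseteq> characters"
        using character_mult[OF cnj_character(1) \<kappa>c] by blast
    qed
    then obtain V where V: "open V"
      "V \<inter> characters = (\<lambda>\<alpha>. Re (f (\<rho>\<^sub>1 * ((cnj \<circ> \<alpha>) * \<kappa>)))) -` {..<1 - \<epsilon>} \<inter> characters"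
      unfolding continuous_on_open_invariant by (metis open_lessThan)
    have "\<kappa> \<in> (\<lambda>\<alpha>. Re (f (\<rho>\<^sub>1 * ((cnj \<circ> \<alpha>) * \<kappa>)))) -` {..<1 - \<epsilon>} \<inter> characters"
      using \<kappa>c cnj_character(3)[OF \<kappa>c] \<epsilon> by simp
    then have "\<kappa> \<in> V" using V by blast
    then have "V \<inter> range \<theta> \<noteq> {}"
      using \<kappa> V(1) unfolding C_def by (auto simp: closure_iff_nhds_not_empty)
    then obtain y where "\<theta> y \<in> V" by blast
    then have "\<theta> y \<in> (\<lambda>\<alpha>. Re (f (\<rho>\<^sub>1 * ((cnj \<circ> \<alpha>) * \<kappa>)))) -` {..<1 - \<epsilon>}" using V \<theta> by blast
    then have "Re (f (\<rho>\<^sub>1 * \<theta> (- y) * \<kappa>)) < 1 - \<epsilon>" by (simp add: cnj_\<theta> mult.assoc)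
    then have "\<kappa> \<in> U y" using U(2)[of y] \<kappa>c by blast
    then show "\<kappa> \<in> (\<Union>y\<in>UNIV. U y)" by blast
  qed
  obtain Y where Y: "finite Y" "C \<subseteq> (\<Union>y\<in>Y. U y)"
    by (rule compactE_image[OF \<open>compact C\<close> U(1) cover])
  have hit: "\<exists>y\<in>Y. Re (f (\<rho>\<^sub>1 * \<theta> (- y) * \<theta> v)) < 1 - \<epsilon>" for v
  proof -
    have "\<theta> v \<in> C" unfolding C_def by (rule subsetD[OF closure_subset rangeI])
    then obtain y where y: "y \<in> Y" "\<theta> v \<in> U y" using Y(2) by (metis UN_E subsetD)
    then have "\<theta> v \<in> U y \<inter> characters" using \<theta> by simp
    then show ?thesis using y(1) unfolding U(2) by auto
  qed
  \<comment> \<open>Again half of the modulus goes into the base point. On the line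
    \<open>Re z = 1/2\<close> the halves combine to
    \<open>\<rho>\<^sub>1 * \<theta> (- y) * \<theta> (Im z)\<close>, the point controlled by
    \<open>hit\<close>.\<close>
  define \<psi> where "\<psi> y = cpower \<rho>\<^sub>1 (1/2) * \<theta> (- y)" for y
  have \<psi>: "\<psi> y \<in> semicharacters - characters" for y
    unfolding \<psi>_def
    by (rule mult_not_character[OF cpower_not_character[OF \<rho>1(1,2)] characterD(1)[OF \<theta>]]) simp
  have in_sc: "cpower \<rho>\<^sub>1 z * \<psi> y \<in> semicharacters" if "0 < Re z" for z y
    using that \<psi> cpower_semicharacter[OF \<rho>1(1)] by (intro semicharacter_mult) auto
  \<comment> \<open>For \<open>Re z > 0\<close> all summands have real part at most 0, and on the
    line \<open>Re z = 1/2\<close> one of them falls below \<open>- \<epsilon>\<close> by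
    \<open>hit\<close>. Passing to \<open>exp (g z)\<close> turns these bounds on real parts into
    bounds on a modulus.\<close>
  define g where "g z = (\<Sum>y\<in>Y. f (cpower \<rho>\<^sub>1 z * \<psi> y) - 1)" for z
  have Re_g: "Re (g z) = (\<Sum>y\<in>Y. Re (f (cpower \<rho>\<^sub>1 z * \<psi> y)) - 1)" for z
    unfolding g_def by simp
  have "cmod (exp (g w)) \<le> exp (- \<epsilon>)" if "1/2 \<le> Re w" for w
  proof (rule bounded_half_plane_max[where h = "\<lambda>z. exp (g z)" and a = "1/2" and w = w])
    show "(\<lambda>z. exp (g z)) holomorphic_on {z. 0 < Re z}"
      unfolding g_def by (intro holomorphic_intros gen_analytic_algebraD(2)[OF f \<rho>1(1,2) \<psi>])
    show "cmod (exp (g z)) \<le> 1" if "0 < Re z" for z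
      using Re1[OF in_sc[OF that]] unfolding norm_exp_eq_Re Re_g by (auto intro!: sum_nonpos)
    show "cmod (exp (g z)) \<le> exp (- \<epsilon>)" if z: "Re z = 1/2" for z
    proof -
      have "z = 1/2 + \<i> * of_real (Im z)" using z by (simp add: complex_eq_iff)
      then have "cpower \<rho>\<^sub>1 z = cpower \<rho>\<^sub>1 (1/2) * \<theta> (Im z)" unfolding \<theta>_def by (metis cpower_add)
      then have "cpower \<rho>\<^sub>1 z * \<psi> y
          = (cpower \<rho>\<^sub>1 (1/2) * cpower \<rho>\<^sub>1 (1/2)) * \<theta> (- y) * \<theta> (Im z)" for y
        unfolding \<psi>_def by (simp only: mult_ac)
      moreover have "cpower \<rho>\<^sub>1 (1/2) * cpower \<rho>\<^sub>1 (1/2) = \<rho>\<^sub>1"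
        by (simp flip: cpower_add add: cpower_1[OF \<rho>1(1)])
      ultimately have eq: "cpower \<rho>\<^sub>1 z * \<psi> y = \<rho>\<^sub>1 * \<theta> (- y) * \<theta> (Im z)" for y by simp
      obtain y where y: "y \<in> Y" "Re (f (cpower \<rho>\<^sub>1 z * \<psi> y)) < 1 - \<epsilon>"
        unfolding eq using hit by blast
      have "Re (g z) = (Re (f (cpower \<rho>\<^sub>1 z * \<psi> y)) - 1) + (\<Sum>y\<in>Y - {y}. Re (f (cpower \<rho>\<^sub>1 z * \<psi> y)) - 1)"
        unfolding Re_g by (rule sum.remove[OF Y(1) y(1)])
      moreover have "(\<Sum>y\<in>Y - {y}. Re (f (cpower \<rho>\<^sub>1 z * \<psi> y)) - 1) \<le> 0"
        using Re1[OF in_sc] z by (intro sum_nonpos) simp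
      ultimately show ?thesis using y(2) unfolding norm_exp_eq_Re by simp
    qed
  qed (use that in auto)
  then have bound: "cmod (exp (g (of_real x))) \<le> exp (- \<epsilon>)" if "1/2 \<le> x" for x :: real
    using that by simp
  \<comment> \<open>Under growing powers of \<open>\<rho>\<^sub>1\<close> the value 1 stays and
    values below 1 tend to 0. Since \<open>\<psi> y\<close> is 1 on
    \<open>pos_set \<rho>\<^sub>0\<close>, the limit is \<open>\<rho>\<^sub>0\<close> for every
    \<open>y\<close>.\<close>
  have lim: "((\<lambda>x::real. f (cpower \<rho>\<^sub>1 (of_real x) * \<psi> y)) \<longlongrightarrow> f \<rho>\<^sub>0) at_top" for y
  proof (rule continuous_on_tendsto_compose[OF cont _ \<rho>0s])
    show "\<forall>\<^sub>F x::real in at_top. cpower \<rho>\<^sub>1 (of_real x) * \<psi> y \<in> semicharacters"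
      using eventually_gt_at_top[of "0::real"] by eventually_elim (simp add: in_sc)
    show "((\<lambda>x::real. cpower \<rho>\<^sub>1 (of_real x) * \<psi> y) \<longlongrightarrow> \<rho>\<^sub>0) at_top"
    proof (rule tendsto_fun_coordinatewise)
      fix s
      show "((\<lambda>x::real. (cpower \<rho>\<^sub>1 (of_real x) * \<psi> y) s) \<longlongrightarrow> \<rho>\<^sub>0 s) at_top"
      proof (cases "s \<in> pos_set \<rho>\<^sub>0")
        case True
        then have "\<rho>\<^sub>0 s = 1"
          using \<rho>0(1) unfolding idempotent_semicharacter_iff pos_set_def by force
        then show ?thesis using \<rho>1(3)[OF True] by (simp add: cpower_def \<psi>_def \<theta>_def)
      next
        case False
        then have 0: "\<rho>\<^sub>0 s = 0"
          using \<rho>0(1) unfolding idempotent_semicharacter_iff pos_set_def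
          by (force simp: less_complex_def)
        have "Re (\<rho>\<^sub>1 s) < 1" using \<rho>1(4)[OF False] by (simp add: less_complex_def)
        then have "((\<lambda>x. Re (\<rho>\<^sub>1 s) powr x) \<longlongrightarrow> 0) at_top"
          using pos(1)[of s] by real_asymp
        then have "((\<lambda>x. complex_of_real (Re (\<rho>\<^sub>1 s) powr x) * \<psi> y s) \<longlongrightarrow> complex_of_real 0 * \<psi> y s) at_top"
          by (intro tendsto_intros)
        moreover have "complex_of_real (Re (\<rho>\<^sub>1 s) powr x) = cpower \<rho>\<^sub>1 (of_real x) s" for x
          using pos(1)[of s] unfolding cpower_def by (subst (2) pos(2)) (simp add: powr_of_real)
        ultimately show ?thesis using 0 by simp
      qed
    qed
  qed
  have "((\<lambda>x::real. cmod (exp (g (of_real x)))) \<longlongrightarrow> cmod (exp (\<Sum>y\<in>Y. f \<rho>\<^sub>0 - 1))) at_top"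
    unfolding g_def by (intro tendsto_intros lim)
  then have "((\<lambda>x::real. cmod (exp (g (of_real x)))) \<longlongrightarrow> 1) at_top" using \<rho>0(2) by simp
  moreover have "\<forall>\<^sub>F x::real in at_top. cmod (exp (g (of_real x))) \<le> exp (- \<epsilon>)"
    using eventually_ge_at_top[of "1/2::real"] by eventually_elim (rule bound)
  ultimately have "1 \<le> exp (- \<epsilon>)" by (rule tendsto_upperbound) simp
  then show False using \<epsilon> by simp
qed

text \<open>Every peak set of the family through \<open>\<rho>\<^sub>0\<close> also contains
  \<open>\<rho>\<^sub>1\<close>. A point \<open>t\<close> outside
  \<open>pos_set \<rho>\<^sub>0\<close> has \<open>\<rho>\<^sub>1 t\<close> strictly between 0 and
  1, so \<open>\<rho>\<^sub>1\<close> is neither a character nor equal to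
  \<open>\<rho>\<^sub>0\<close>.\<close>

lemma E0_not_p_point:
  assumes "\<rho>\<^sub>0 \<in> E0_semicharacters"
  shows "\<not> p_point semicharacters gen_analytic_algebra \<rho>\<^sub>0"
proof
  assume p: "p_point semicharacters gen_analytic_algebra \<rho>\<^sub>0"
  obtain \<rho>\<^sub>1 where \<rho>0: "\<rho>\<^sub>0 \<in> idempotent_semicharacters" "pos_set \<rho>\<^sub>0 \<noteq> UNIV"
    and \<rho>1: "\<rho>\<^sub>1 \<in> nonneg_semicharacters" "\<And>s. s \<in> pos_set \<rho>\<^sub>0 \<Longrightarrow> \<rho>\<^sub>1 s = 1"
      "\<And>s. s \<notin> pos_set \<rho>\<^sub>0 \<Longrightarrow> 0 < \<rho>\<^sub>1 s \<and> \<rho>\<^sub>1 s < 1"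
    using assms unfolding E0_semicharacters_def by blast
  obtain t where t: "t \<notin> pos_set \<rho>\<^sub>0" using \<rho>0(2) by blast
  then have r: "0 < Re (\<rho>\<^sub>1 t)" "Re (\<rho>\<^sub>1 t) < 1" "Im (\<rho>\<^sub>1 t) = 0" using \<rho>1(3) by (auto simp: less_complex_def)
  then have "cmod (\<rho>\<^sub>1 t) \<noteq> 1" by (simp add: cmod_def)
  then have nc: "\<rho>\<^sub>1 \<notin> characters" using characterD(2) by blast
  obtain \<P> where \<P>: "\<And>P. P \<in> \<P> \<Longrightarrow> peak_set semicharacters gen_analytic_algebra P" "\<Inter>\<P> = {\<rho>\<^sub>0}"
    using p unfolding p_point_def by blast
  have "\<rho>\<^sub>1 \<in> P" if "P \<in> \<P>" for P
  proof -
    obtain f where f: "f \<in> gen_analytic_algebra" and fP: "P \<subseteq> semicharacters"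
      "\<forall>y\<in>P. f y = 1" "\<forall>y\<in>semicharacters - P. cmod (f y) < 1"
      using \<P>(1)[OF \<open>P \<in> \<P>\<close>] unfolding peak_set_def by blast
    have "f \<rho>\<^sub>0 = 1" using fP(2) \<P>(2) \<open>P \<in> \<P>\<close> by blast
    then have "f \<rho>\<^sub>1 = 1"
      using E0_peak_function[OF f peak_function_le_1[OF fP] \<rho>0(1) _ \<rho>1(1) nc \<rho>1(2,3)] by blast
    moreover have "\<rho>\<^sub>1 \<in> semicharacters" using \<rho>1(1) unfolding nonneg_semicharacters_def by blast
    ultimately show ?thesis using fP(3) by (metis DiffI less_irrefl norm_one)
  qed
  then have "\<rho>\<^sub>1 = \<rho>\<^sub>0" using \<P>(2) by blast
  then have "\<rho>\<^sub>1 t = 0 \<or> \<rho>\<^sub>1 t = 1" using \<rho>0(1) unfolding idempotent_semicharacter_iff by blast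
  then show False using r by auto
qed

theorem mainTheorem1:
  fixes \<Gamma> :: "('a::comm_monoid_mult \<Rightarrow> complex) set"
  assumes cancellative: "\<forall>a b c :: 'a. a * b = a * c \<longrightarrow> b = c"
    and \<Gamma>: "\<Gamma> = strong_boundary semicharacters gen_analytic_algebra"
  shows "\<exists>F \<subseteq> idempotent_semicharacters.
      (\<forall>\<rho>\<in>F. is_maximal_subgroup \<rho> ((\<lambda>\<phi>. \<rho> * \<phi>) ` characters)) \<and>
      disjoint_family_on (\<lambda>\<rho>. (\<lambda>\<phi>. \<rho> * \<phi>) ` characters) F \<and>
      \<Gamma> = (\<Union>\<rho>\<in>F. (\<lambda>\<phi>. \<rho> * \<phi>) ` characters) \<and>
      (countable (UNIV :: 'a set) \<longrightarrow> 1 \<in> F \<and> E0_semicharacters \<inter> F = {})"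
proof -
  \<comment> \<open>The choice is forced: \<open>modulus\<close> recovers \<open>\<rho>\<close> from
    any point of its coset, so the coset contains no other idempotent. Disjointness has the same
    reason.\<close>
  define F where "F = \<Gamma> \<inter> idempotent_semicharacters"
  have \<Gamma>_iff: "\<psi> \<in> \<Gamma> \<longleftrightarrow> p_point semicharacters gen_analytic_algebra \<psi>" for \<psi>
    unfolding \<Gamma> strong_boundary_def by simp
  have "disjoint_family_on (\<lambda>\<rho>. (\<lambda>\<phi>. \<rho> * \<phi>) ` characters) F"
    unfolding disjoint_family_on_def
  proof (intro ballI impI equals0I)
    fix \<rho> \<rho>' \<psi>
    assume A: "\<rho> \<in> F" "\<rho>' \<in> F" "\<rho> \<noteq> \<rho>'" "\<psi> \<in> (\<lambda>\<phi>. \<rho> * \<phi>) ` characters \<inter> (\<lambda>\<phi>. \<rho>' * \<phi>) ` characters"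
    obtain \<phi> where "\<psi> = \<rho> * \<phi>" "\<phi> \<in> characters" using IntD1[OF A(4)] by blast
    moreover obtain \<phi>' where "\<psi> = \<rho>' * \<phi>'" "\<phi>' \<in> characters" using IntD2[OF A(4)] by blast
    ultimately have "modulus \<psi> = \<rho>" "modulus \<psi> = \<rho>'"
      using modulus_idempotent_mult_character[of \<rho> \<phi>] modulus_idempotent_mult_character[of \<rho>' \<phi>'] A
      unfolding F_def by auto
    then show False using A(3) by simp
  qed
  moreover have "\<Gamma> = (\<Union>\<rho>\<in>F. (\<lambda>\<phi>. \<rho> * \<phi>) ` characters)"
  proof (intro equalityI subsetI)
    fix \<psi> assume \<psi>: "\<psi> \<in> \<Gamma>"
    then have p: "p_point semicharacters gen_analytic_algebra \<psi>" unfolding \<Gamma>_iff .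
    then have "\<psi> \<in> semicharacters" unfolding p_point_def by blast
    then obtain \<theta> where \<theta>: "\<theta> \<in> characters" "\<psi> = modulus \<psi> * \<theta>"
      using polar_decomposition[OF cancellative] by blast
    \<comment> \<open>Translation by the conjugate character strips off the phase, so
      \<open>modulus \<psi>\<close> is a \<open>p\<close>-point along with
      \<open>\<psi>\<close>.\<close>
    have "\<psi> * (cnj \<circ> \<theta>) = modulus \<psi> * (\<theta> * (cnj \<circ> \<theta>))"
      by (subst \<theta>(2)) (rule mult.assoc)
    then have "modulus \<psi> = \<psi> * (cnj \<circ> \<theta>)" using cnj_character(2)[OF \<theta>(1)] by simp
    then have "modulus \<psi> \<in> \<Gamma>"
      using p_point_translate[OF p cnj_character(1)[OF \<theta>(1)]] unfolding \<Gamma>_iff by simp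
    then have "modulus \<psi> \<in> F"
      using p_point_modulus_idempotent[OF cancellative p] unfolding F_def by blast
    then show "\<psi> \<in> (\<Union>\<rho>\<in>F. (\<lambda>\<phi>. \<rho> * \<phi>) ` characters)" using \<theta> by blast
  next
    fix \<psi> assume "\<psi> \<in> (\<Union>\<rho>\<in>F. (\<lambda>\<phi>. \<rho> * \<phi>) ` characters)"
    then show "\<psi> \<in> \<Gamma>" by (auto simp: F_def \<Gamma>_iff intro: p_point_translate)
  qed
  moreover have "1 \<in> F"
    using one_p_point characterD(1)[OF one_character]
    unfolding F_def \<Gamma>_iff idempotent_semicharacters_def by (simp add: \<Gamma>_iff)
  moreover have "E0_semicharacters \<inter> F = {}"
    by (auto simp: F_def \<Gamma>_iff dest: E0_not_p_point)
  ultimately show ?thesis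
    using maximal_subgroup_coset[OF cancellative] unfolding F_def by (intro exI[of _ F]) (auto simp: F_def)
qed

end
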